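(* Let $\boldsymbol{s}=(s_1,\dots,s_K)$ be a fixed vector of non-negative integers. For $1\le i\le K$ let $\alpha_{i0}$ be a real number such that $m_i(\theta_{\alpha_{i0}})=\alpha_{i0}$ for some $\theta_{\alpha_{i0}}$ with $0<\theta_{\alpha_{i0}}<R_i$. For positive integers $N$ and $\boldsymbol{n}=(n_1,\dots,n_K)$ let $\mu_{\boldsymbol{s}\boldsymbol{n}N}$ be the number of boxes containing exactly $s_i$ balls of colour $i$ for every $1\le i\le K$ in the multi-colour generalized allocation scheme of placing $n_i$ balls of colour $i$ ($1\le i\le K$) into $N$ boxes. Then, almost surely, $$\frac1N\mu_{\boldsymbol{s}\boldsymbol{n}N}\to\prod_{i=1}^K\frac{b_{is_i}\theta_{\alpha_{i0}}^{s_i}}{s_i!\,B_i(\theta_{\alpha_{i0}})}$$ as $N\to\infty$, $n_i\to\infty$ such that $n_i/N=\alpha_i\to\alpha_{i0}$, $1\le i\le K$.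
   Context: $K\ge1$ is a fixed integer (the number of colours). For each $1\le i\le K$, $(b_{ik})_{k\ge0}$ is a sequence of non-negative real numbers with $b_{i0}>0$, $b_{i1}>0$, such that the power series $B_i(\theta)=\sum_{k=0}^\infty \frac{b_{ik}\theta^k}{k!}$ has positive (possibly infinite) radius of convergence $R_i$. For $0<\theta<R_i$, $\xi_i(\theta)$ denotes a random variable with $\mathbb{P}\{\xi_i(\theta)=k\}=\frac{b_{ik}\theta^k}{k!B_i(\theta)}$, $k=0,1,2,\dots$, and $m_i(\theta)=\mathbb{E}\,\xi_i(\theta)=\theta B_i'(\theta)/B_i(\theta)$. Multi-colour generalized allocation scheme: for $N$ boxes and $n_i$ balls of colour $i$ ($1\le i\le K$), it is a family of random vectors $\boldsymbol{\eta}_j=(\eta_{1j},\dots,\eta_{Kj})$, $1\le j\le N$, with non-negative integer coordinates ($\eta_{ij}$ is the number of balls of colour $i$ in box $j$) whose joint distribution is $$\mathbb{P}\{\boldsymbol{\eta}_1=\boldsymbol{k}_1,\dots,\boldsymbol{\eta}_N=\boldsymbol{k}_N\}=\prod_{i=1}^K\mathbb{P}\{\xi_{i1}=k_{i1},\dots,\xi_{iN}=k_{iN}\mid \xi_{i1}+\dots+\xi_{iN}=n_i\}$$ for all non-negative integer vectors $\boldsymbol{k}_j=(k_{1j},\dots,k_{Kj})$ with $k_{i1}+\dots+k_{iN}=n_i$, $1\le i\le K$. Here all $\xi_{ij}$ are independent and, for each $i$, $\xi_{i1},\dots,\xi_{iN}$ are independent copies of $\xi_i(\theta_i)$ for some $\theta_i\in(0,R_i)$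 (the conditional distribution does not depend on the choice of $\theta_i$). The number of boxes with contents exactly $\boldsymbol{s}=(s_1,\dots,s_K)$ is $\mu_{\boldsymbol{s}\boldsymbol{n}N}=\sum_{j=1}^{N}\prod_{i=1}^K\mathbb{I}_{\{\eta_{ij}=s_i\}}$, where $\mathbb{I}$ denotes the indicator. For different $(\boldsymbol{n},N)$ the allocation schemes are defined on one common probability space; nothing is assumed about their joint distribution. The scheme is considered for parameters for which the conditioning events have positive probability (this holds for all sufficiently large $N$ when each $n_i/N$ is sufficiently close to $\alpha_{i0}$). The almost sure limit is the multi-index one: there is an event of probability one on which, for every $\varepsilon>0$, there exist $M$ and $\delta>0$ such that the two sides differ by less than $\varepsilon$ for all $(\boldsymbol{n},N)$ with $N\ge M$, $n_i\ge M$ and $|n_i/N-\alpha_{i0}|<\delta$ for all $1\le i\le K$. *)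

theory Defs
  imports "HOL-Probability.Probability"
begin

definition alloc_radius :: "(nat \<Rightarrow> real) \<Rightarrow> ereal" where
  "alloc_radius b = conv_radius (\<lambda>k. b k / fact k)"

definition alloc_series :: "(nat \<Rightarrow> real) \<Rightarrow> real \<Rightarrow> real" where
  "alloc_series b \<theta> = (\<Sum>k. b k * \<theta> ^ k / fact k)"

text \<open>The law of \<open>\<xi>(\<theta>)\<close>. It is meaningful only for admissible \<open>b\<close> and
  \<open>0 < \<theta> < alloc_radius b\<close>; see \<open>pmf_xi_pmf\<close> below.\<close>

definition xi_pmf :: "(nat \<Rightarrow> real) \<Rightarrow> real \<Rightarrow> nat pmf" where
  "xi_pmf b \<theta> = embed_pmf (\<lambda>k. b k * \<theta> ^ k / (fact k * alloc_series b \<theta>))"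

definition xi_mean :: "(nat \<Rightarrow> real) \<Rightarrow> real \<Rightarrow> real" where
  "xi_mean b \<theta> = measure_pmf.expectation (xi_pmf b \<theta>) real"

text \<open>The joint law of \<open>N\<close> independent copies of \<open>\<xi>(\<theta>)\<close>, indexed by the boxes
  \<open>1, \<dots>, N\<close> (coordinates outside this range are \<open>0\<close>).\<close>

definition xi_copies :: "(nat \<Rightarrow> real) \<Rightarrow> real \<Rightarrow> nat \<Rightarrow> (nat \<Rightarrow> nat) pmf" where
  "xi_copies b \<theta> N = Pi_pmf {1..N} 0 (\<lambda>_. xi_pmf b \<theta>)"

text \<open>The colours are the elements of a finite type \<open>'k\<close>, so \<open>K\<close> is \<open>CARD('k)\<close>.
  The random variable \<open>\<eta> i j\<close> is the number of balls of colour \<open>i\<close> in box \<open>j\<close>.\<close>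

definition allocation_scheme ::
    "'w measure \<Rightarrow> ('k::finite \<Rightarrow> nat \<Rightarrow> real) \<Rightarrow> ('k \<Rightarrow> real) \<Rightarrow> ('k \<Rightarrow> nat) \<Rightarrow> nat
      \<Rightarrow> ('k \<Rightarrow> nat \<Rightarrow> 'w \<Rightarrow> nat) \<Rightarrow> bool" where
  "allocation_scheme M b \<theta> n N \<eta> \<longleftrightarrow>
     (\<forall>i. \<forall>j\<in>{1..N}. \<eta> i j \<in> measurable M (count_space UNIV)) \<and>
     (\<forall>k :: 'k \<Rightarrow> nat \<Rightarrow> nat. (\<forall>i. (\<Sum>j=1..N. k i j) = n i) \<longrightarrow>
        \<P>(\<omega> in M. \<forall>j\<in>{1..N}. \<forall>i. \<eta> i j \<omega> = k i j) =
        (\<Prod>i\<in>UNIV. \<P>(x in measure_pmf (xi_copies (b i) (\<theta> i) N).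
            (\<forall>j\<in>{1..N}. x j = k i j) \<bar> (\<Sum>j=1..N. x j) = n i)))"

definition box_count ::
    "('k::finite \<Rightarrow> nat) \<Rightarrow> nat \<Rightarrow> ('k \<Rightarrow> nat \<Rightarrow> 'w \<Rightarrow> nat) \<Rightarrow> 'w \<Rightarrow> real" where
  "box_count s N \<eta> \<omega> = (\<Sum>j=1..N. \<Prod>i\<in>UNIV. indicator {\<omega>'. \<eta> i j \<omega>' = s i} \<omega>)"

lemma alloc_series_sums:
  assumes "0 < \<theta>" "ereal \<theta> < alloc_radius b"
  shows "(\<lambda>k. b k * \<theta> ^ k / fact k) sums alloc_series b \<theta>"
proof -
  have "summable (\<lambda>k. b k / fact k * \<theta> ^ k)"
    using assms by (intro summable_in_conv_radius) (simp add: alloc_radius_def)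
  then show ?thesis
    by (simp add: alloc_series_def summable_sums)
qed

lemma pmf_xi_pmf:
  assumes nonneg: "\<And>k. 0 \<le> b k" and b0: "0 < b 0"
    and \<theta>: "0 < \<theta>" "ereal \<theta> < alloc_radius b"
  shows "pmf (xi_pmf b \<theta>) k = b k * \<theta> ^ k / (fact k * alloc_series b \<theta>)"
proof -
  let ?f = "\<lambda>k. b k * \<theta> ^ k / (fact k * alloc_series b \<theta>)"
  note sums = alloc_series_sums[OF \<theta>]
  have "0 < (\<Sum>k. b k * \<theta> ^ k / fact k)"
    using nonneg b0 \<theta>(1) by (intro suminf_pos2[OF sums_summable[OF sums], of 0]) auto
  then have pos: "0 < alloc_series b \<theta>"
    by (simp add: alloc_series_def)
  have nn: "0 \<le> ?f k" for k
    using nonneg pos \<theta>(1) by simp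
  have "?f sums 1"
    using sums_divide[OF sums, of "alloc_series b \<theta>"] pos by simp
  then have "(\<integral>\<^sup>+ k. ennreal (?f k) \<partial>count_space UNIV) = 1"
    using nn by (simp add: nn_integral_count_space_nat suminf_ennreal_eq sums_iff)
  then show ?thesis
    unfolding xi_pmf_def using nn by (intro pmf_embed_pmf) auto
qed

end

theory Submission
  imports Defs "HOL-Real_Asymp.Real_Asymp"
begin

text \<open>
  Let \<open>p\<^sub>i\<close> be the law of \<open>\<xi>\<^sub>i(\<theta>\<^sub>0 i)\<close>, and call \<^emph>\<open>free allocation\<close> the model in which all
  \<open>\<xi>\<^sub>i\<^sub>j\<close> are independent, with law \<open>p\<^sub>i\<close>, and nothing is conditioned on. In the free allocation
  the contents of different boxes are independent and identically distributed, and a given box has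
  contents \<open>s\<close> with probability exactly the limit claimed. Hoeffding's inequality therefore bounds
  the probability that the proportion of such boxes deviates from the limit by \<open>\<epsilon>\<close> by
  \<open>2 exp (- 2 \<epsilon>\<^sup>2 N)\<close> (\<open>free_allocation_tail\<close>).

  The allocation scheme is the free allocation conditioned on the numbers \<open>n i\<close> of balls. This
  conditional law is the same for every parameter, because changing \<open>\<theta>\<close> multiplies the probability
  of a configuration by a factor that depends on \<open>n\<close> and \<open>N\<close> only (\<open>cond_prob_xi_copies\<close>); so the
  parameter can be taken to be \<open>\<theta>\<^sub>0\<close> throughout. Conditioning costs at most the factor
  \<open>1 / (\<Prod>i. P (S\<^sub>i = n i))\<close>, where \<open>S\<^sub>i\<close> is the sum of \<open>N\<close> independent copies of \<open>\<xi>\<^sub>i\<close>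
  (\<open>allocation_transfer\<close>). Since Hoeffding's inequality gains an exponential factor, a crude bound is
  enough: for any prescribed \<open>\<gamma> > 0\<close>, \<open>P (S\<^sub>i = n i) \<ge> exp (- \<gamma> N)\<close> once \<open>N\<close> is large and \<open>n i / N\<close>
  is close to the mean \<open>\<alpha>\<^sub>0 i\<close> (\<open>sum_prob_subexponential\<close>). To see this, split off a small proportion of the
  copies. By Chebyshev's inequality the sum of the others is near its mean with probability at least
  \<open>1 / 2\<close>, and whatever is then missing from \<open>n i\<close> is made up by the copies set aside, each taking
  one of the values \<open>0\<close>, \<open>1\<close>, \<open>k\<close>, where \<open>k\<close> is a value of \<open>\<xi>\<^sub>i\<close> above its mean; this costs a constant
  factor per copy set aside.

  With \<open>\<gamma> = \<epsilon>\<^sup>2 / K\<close> the deviation probability is at most \<open>2 exp (- \<epsilon>\<^sup>2 N)\<close>. For each \<open>N\<close> only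
  polynomially many \<open>n\<close> have all \<open>n i / N\<close> close to \<open>\<alpha>\<^sub>0 i\<close>, so a union bound over these \<open>n\<close> and the
  Borel--Cantelli lemma over \<open>N\<close> yield almost sure convergence along all indices at once
  (\<open>AE_multi_index_limit\<close>), whatever the joint distribution of the schemes.
\<close>

section \<open>Sums of independent copies\<close>

definition iid_sum_pmf :: "nat pmf \<Rightarrow> nat \<Rightarrow> nat pmf" where
  "iid_sum_pmf p N = map_pmf (\<lambda>x. \<Sum>j=1..N. x j) (Pi_pmf {1..N} 0 (\<lambda>_. p))"

lemma iid_sum_pmf_0 [simp]: "iid_sum_pmf p 0 = return_pmf 0"
  by (simp add: iid_sum_pmf_def)

lemma iid_sum_pmf_Suc:
  "iid_sum_pmf p (Suc N) = bind_pmf (iid_sum_pmf p N) (\<lambda>m. map_pmf (\<lambda>k. m + k) p)"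
proof -
  have *: "(\<Sum>j=1..N. (x(Suc N := k)) j) = (\<Sum>j=1..N. x j)" for x :: "nat \<Rightarrow> nat" and k
    by (rule sum.cong) auto
  have "iid_sum_pmf p (Suc N) =
    bind_pmf p (\<lambda>k. bind_pmf (Pi_pmf {1..N} 0 (\<lambda>_. p)) (\<lambda>x. return_pmf ((\<Sum>j=1..N. x j) + k)))"
    unfolding iid_sum_pmf_def
    by (simp add: atLeastAtMostSuc_conv Pi_pmf_insert' map_bind_pmf map_pmf_def bind_assoc_pmf
        bind_return_pmf * add.commute)
  also have "\<dots> = bind_pmf (iid_sum_pmf p N) (\<lambda>m. map_pmf (\<lambda>k. m + k) p)"
    unfolding iid_sum_pmf_def map_pmf_def
    by (subst bind_commute_pmf) (simp add: bind_assoc_pmf bind_return_pmf)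
  finally show ?thesis .
qed

lemma iid_sum_pmf_add:
  "iid_sum_pmf p (a + c) = bind_pmf (iid_sum_pmf p a) (\<lambda>m. map_pmf (\<lambda>k. m + k) (iid_sum_pmf p c))"
proof (induction c)
  case 0
  then show ?case by (simp add: bind_return_pmf')
next
  case (Suc c)
  then show ?case
    by (simp add: iid_sum_pmf_Suc map_pmf_def bind_assoc_pmf bind_return_pmf add.assoc)
qed

lemma pmf_iid_sum_add:
  "pmf (iid_sum_pmf p (a + c)) n =
   (\<integral>m. (if m \<le> n then pmf (iid_sum_pmf p c) (n - m) else 0) \<partial>iid_sum_pmf p a)"
proof -
  have "pmf (map_pmf (\<lambda>k. m + k) (iid_sum_pmf p c)) n =
        (if m \<le> n then pmf (iid_sum_pmf p c) (n - m) else 0)" for m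
  proof (cases "m \<le> n")
    case True
    then show ?thesis
      using pmf_map_inj'[of "\<lambda>k. m + k" "iid_sum_pmf p c" "n - m"] by (simp add: inj_def)
  next
    case False
    then have "n \<notin> set_pmf (map_pmf (\<lambda>k. m + k) (iid_sum_pmf p c))" by auto
    then show ?thesis using False by (simp add: pmf_eq_0_set_pmf del: set_map_pmf)
  qed
  then show ?thesis
    by (simp add: iid_sum_pmf_add pmf_bind)
qed

text \<open>
  The second moment is kept as a nonnegative integral, so that the recursion over \<open>N\<close> needs
  integrability only of a single copy. The cross term vanishes in the inner integral, because each
  new copy is centred.
\<close>

lemma iid_sum_second_moment:
  fixes p :: "nat pmf" and \<alpha> :: real
  assumes int: "integrable (measure_pmf p) (\<lambda>k. real k)" "integrable (measure_pmf p) (\<lambda>k. (real k)\<^sup>2)"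
    and \<alpha>: "measure_pmf.expectation p real = \<alpha>"
  shows "(\<integral>\<^sup>+ m. ennreal ((real m - real N * \<alpha>)\<^sup>2) \<partial>iid_sum_pmf p N) =
    ennreal (real N * measure_pmf.variance p real)"
proof (induction N)
  case 0
  then show ?case by simp
next
  case (Suc N)
  let ?v = "measure_pmf.variance p real"
  have inner: "(\<integral>\<^sup>+ k. ennreal ((real (m + k) - real (Suc N) * \<alpha>)\<^sup>2) \<partial>p) =
     ennreal ((real m - real N * \<alpha>)\<^sup>2) + ennreal ?v" for m
  proof -
    let ?y = "real m - real N * \<alpha>"
    have eq: "(real (m + k) - real (Suc N) * \<alpha>)\<^sup>2 = ?y\<^sup>2 + 2 * ?y * (real k - \<alpha>) + (real k - \<alpha>)\<^sup>2" for k
      by (simp add: power2_eq_square algebra_simps)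
    have i2: "integrable (measure_pmf p) (\<lambda>k. (real k - \<alpha>)\<^sup>2)"
      using int by (simp add: power2_diff)
    have "(\<integral>\<^sup>+ k. ennreal ((real (m + k) - real (Suc N) * \<alpha>)\<^sup>2) \<partial>p) =
       ennreal (\<integral>k. ?y\<^sup>2 + 2 * ?y * (real k - \<alpha>) + (real k - \<alpha>)\<^sup>2 \<partial>p)"
      unfolding eq[symmetric]
    proof (rule nn_integral_eq_integral)
      show "integrable (measure_pmf p) (\<lambda>k. (real (m + k) - real (Suc N) * \<alpha>)\<^sup>2)"
        unfolding eq using int i2 by simp
    qed simp
    also have "(\<integral>k. ?y\<^sup>2 + 2 * ?y * (real k - \<alpha>) + (real k - \<alpha>)\<^sup>2 \<partial>p) = ?y\<^sup>2 + ?v"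
      using int i2 by (simp add: \<alpha>)
    finally show ?thesis by (simp add: ennreal_plus)
  qed
  have "(\<integral>\<^sup>+ m. ennreal ((real m - real (Suc N) * \<alpha>)\<^sup>2) \<partial>iid_sum_pmf p (Suc N)) =
    (\<integral>\<^sup>+ m. ennreal ((real m - real N * \<alpha>)\<^sup>2) + ennreal ?v \<partial>iid_sum_pmf p N)"
    by (simp add: iid_sum_pmf_Suc inner del: of_nat_add of_nat_Suc)
  also have "\<dots> = ennreal (real N * ?v) + ennreal ?v"
    by (simp add: nn_integral_add Suc)
  also have "\<dots> = ennreal (real (Suc N) * ?v)"
    by (simp add: ennreal_plus[symmetric] algebra_simps del: ennreal_plus)
  finally show ?case .
qed

lemma iid_sum_Chebyshev:
  fixes p :: "nat pmf" and \<alpha> :: real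
  assumes int: "integrable (measure_pmf p) (\<lambda>k. real k)" "integrable (measure_pmf p) (\<lambda>k. (real k)\<^sup>2)"
    and \<alpha>: "measure_pmf.expectation p real = \<alpha>" and "0 < t"
  shows "measure (iid_sum_pmf p N) {m. t \<le> \<bar>real m - real N * \<alpha>\<bar>} \<le>
    real N * measure_pmf.variance p real / t\<^sup>2"
proof -
  let ?M = "measure_pmf (iid_sum_pmf p N)" and ?v = "measure_pmf.variance p real"
  let ?f = "\<lambda>m. (real m - real N * \<alpha>)\<^sup>2"
  have i: "integrable ?M ?f"
    by (rule integrableI_bounded)
      (simp_all add: iid_sum_second_moment[OF int \<alpha>])
  have "measure_pmf.expectation (iid_sum_pmf p N) ?f = real N * ?v"
    by (rule integral_eq_nn_integral[THEN trans]) (auto simp: iid_sum_second_moment[OF int \<alpha>])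
  moreover have "measure ?M {m \<in> space ?M. t\<^sup>2 \<le> ?f m} \<le> measure_pmf.expectation (iid_sum_pmf p N) ?f / t\<^sup>2"
    using \<open>0 < t\<close> by (intro integral_Markov_inequality_measure[OF i]) auto
  moreover have "t\<^sup>2 \<le> ?f m \<longleftrightarrow> t \<le> \<bar>real m - real N * \<alpha>\<bar>" for m
    using \<open>0 < t\<close> abs_le_square_iff[of t "real m - real N * \<alpha>"] by simp
  ultimately show ?thesis by simp
qed

text \<open>
  One way to reach the total \<open>q * k + u\<close> with \<open>r\<close> copies is that \<open>q\<close> of them take the value \<open>k\<close>,
  \<open>u\<close> the value \<open>1\<close> and the rest the value \<open>0\<close>.
\<close>

lemma iid_sum_reachable:
  assumes c: "0 \<le> c" "c \<le> pmf p 0" "c \<le> pmf p 1" "c \<le> pmf p k" and "q + u \<le> r"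
  shows "c ^ r \<le> pmf (iid_sum_pmf p r) (q * k + u)"
proof -
  have step: "pmf (iid_sum_pmf p a) m * pmf p l \<le> pmf (iid_sum_pmf p (Suc a)) (m + l)" for a m l
  proof -
    have plus_0_id: "(+) (0 :: nat) = id" by auto
    have p1: "iid_sum_pmf p (Suc 0) = p"
      by (simp add: iid_sum_pmf_Suc bind_return_pmf plus_0_id)
    have "pmf (iid_sum_pmf p a) m * pmf p l = 
      (\<integral>x. pmf p l * indicator {m} x \<partial>iid_sum_pmf p a)"
      by (simp add: measure_pmf_single)
    also have "\<dots> \<le> (\<integral>x. (if x \<le> m + l then pmf p (m + l - x) else 0) \<partial>iid_sum_pmf p a)"
      by (rule integral_mono)
        (auto intro!: measure_pmf.integrable_const_bound[where B = 1] simp: pmf_le_1 indicator_def)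
    finally show ?thesis
      using pmf_iid_sum_add[of p a "Suc 0" "m + l", unfolded p1] by simp
  qed
  have mono: "c ^ Suc a \<le> pmf (iid_sum_pmf p (Suc a)) (m + l)"
    if "c ^ a \<le> pmf (iid_sum_pmf p a) m" "c \<le> pmf p l" for a m l
    using order_trans[OF mult_mono[OF that] step] c(1) by (simp add: mult.commute)
  have q: "c ^ q \<le> pmf (iid_sum_pmf p q) (q * k)" for q
  proof (induction q)
    case (Suc q)
    then show ?case using mono[of q "q * k" k] c by (simp add: add.commute)
  qed simp
  have u: "c ^ (q + u) \<le> pmf (iid_sum_pmf p (q + u)) (q * k + u)" for u
  proof (induction u)
    case (Suc u)
    then show ?case using mono[of "q + u" "q * k + u" 1] c by simp
  qed (use q in simp)
  have "c ^ (q + u + v) \<le> pmf (iid_sum_pmf p (q + u + v)) (q * k + u)" for v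
  proof (induction v)
    case (Suc v)
    then show ?case using mono[of "q + u + v" "q * k + u" 0] c by simp
  qed (use u in simp)
  from this[of "r - (q + u)"] show ?thesis using \<open>q + u \<le> r\<close> by simp
qed

section \<open>Lower bounds for the sum hitting a value near its mean\<close>

text \<open>
  Of the \<open>N\<close> copies, the last \<open>r\<close> are set aside for correction. With probability at least \<open>1 / 2\<close>, which
  \<open>var\<close> ensures by Chebyshev's inequality, the first \<open>N - r\<close> copies sum to some \<open>m\<close> within \<open>\<delta> * N\<close> of
  their mean. The first \<open>room\<close> condition makes the missing amount \<open>n - m\<close> nonnegative. The second keeps
  \<open>n - m\<close> at most \<open>k * (r - k)\<close>, which leaves enough copies to write \<open>n - m\<close> with division by \<open>k\<close>, using
  the value \<open>k\<close> for the quotient and the value \<open>1\<close> for the remainder.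
\<close>

lemma iid_sum_lower_bound_split:
  fixes p :: "nat pmf" and \<alpha> :: real
  assumes int: "integrable (measure_pmf p) (\<lambda>k. real k)" "integrable (measure_pmf p) (\<lambda>k. (real k)\<^sup>2)"
    and \<alpha>: "measure_pmf.expectation p real = \<alpha>"
    and c: "0 \<le> c" "c \<le> pmf p 0" "c \<le> pmf p 1" "c \<le> pmf p k"
    and "0 < \<delta>" and k: "0 < k" and r: "r \<le> N" "0 < N"
    and var: "2 * measure_pmf.variance p real \<le> \<delta>\<^sup>2 * real N"
    and n: "\<bar>real n - real N * \<alpha>\<bar> \<le> \<delta> * real N"
    and room: "2 * \<delta> * real N \<le> \<alpha> * real r"
      "2 * \<delta> * real N + (real k)\<^sup>2 \<le> (real k - \<alpha>) * real r"
  shows "c ^ r / 2 \<le> pmf (iid_sum_pmf p N) n"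
proof -
  define a where "a = N - r"
  have N: "N = a + r" "real a = real N - real r"
    using r by (auto simp: a_def of_nat_diff)
  define I where "I = {m. \<bar>real m - real a * \<alpha>\<bar> < \<delta> * real N}"
  \<comment> \<open>Given a typical sum \<open>m\<close> of the first \<open>a\<close> copies, those set aside complete it to \<open>n\<close>
      with probability at least \<open>c ^ r\<close>, uniformly in \<open>m\<close>.\<close>
  have reach: "c ^ r * indicator I m \<le> (if m \<le> n then pmf (iid_sum_pmf p r) (n - m) else 0)" for m
  proof (cases "m \<in> I")
    case True
    have "real m - real a * \<alpha> < \<delta> * real N" "real a * \<alpha> - real m < \<delta> * real N"
      using True by (auto simp: I_def)
    moreover have "real n - real N * \<alpha> \<le> \<delta> * real N" "real N * \<alpha> - real n \<le> \<delta> * real N"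
      using n by auto
    moreover have "real a * \<alpha> = real N * \<alpha> - \<alpha> * real r"
      by (simp add: N(2) algebra_simps)
    ultimately have t: "real m < real n" "real n - real m \<le> \<alpha> * real r + 2 * \<delta> * real N"
      using room(1) by linarith+
    define t where "t = n - m"
    have "real t = real n - real m" using t(1) by (simp add: t_def)
    with t(2) room(2) have "real t + real k * real k \<le> real k * real r"
      by (simp add: algebra_simps power2_eq_square)
    then have tk: "t + k * k \<le> k * r"
      by (metis of_nat_add of_nat_le_iff of_nat_mult)
    have "t mod k < k" using k by simp
    have "k * (t div k + t mod k) \<le> t + k * (t mod k)"
      by (simp add: algebra_simps)
    also have "\<dots> \<le> t + k * k" using k by (simp add: less_imp_le)
    also have "\<dots> \<le> k * r" by (fact tk)
    finally have "t div k + t mod k \<le> r" using k by simp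
    from iid_sum_reachable[OF c this] have "c ^ r \<le> pmf (iid_sum_pmf p r) t"
      by simp
    with True t(1) show ?thesis by (simp add: t_def)
  qed simp
  have "measure (iid_sum_pmf p a) {m. \<delta> * real N \<le> \<bar>real m - real a * \<alpha>\<bar>}
      \<le> real a * measure_pmf.variance p real / (\<delta> * real N)\<^sup>2"
    using \<open>0 < \<delta>\<close> \<open>0 < N\<close> by (intro iid_sum_Chebyshev[OF int \<alpha>]) simp
  also have "\<dots> \<le> real N * measure_pmf.variance p real / (\<delta> * real N)\<^sup>2"
    by (intro divide_right_mono mult_right_mono integral_nonneg) (auto simp: a_def)
  also have "\<dots> \<le> 1 / 2"
    using var \<open>0 < \<delta>\<close> \<open>0 < N\<close> by (simp add: field_simps power2_eq_square)
  finally have "measure (iid_sum_pmf p a) (- I) \<le> 1 / 2"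
    by (simp add: I_def Collect_neg_eq[symmetric] not_less)
  then have "1 / 2 \<le> measure (iid_sum_pmf p a) I"
    using measure_pmf.prob_compl[of I "iid_sum_pmf p a"] by (simp add: Compl_eq_Diff_UNIV)
  then have "c ^ r / 2 \<le> c ^ r * measure (iid_sum_pmf p a) I"
    using mult_left_mono[of "1/2" "measure (iid_sum_pmf p a) I" "c ^ r"] c(1) by simp
  also have "\<dots> = (\<integral>m. c ^ r * indicator I m \<partial>iid_sum_pmf p a)"
    by simp
  also have "\<dots> \<le> (\<integral>m. (if m \<le> n then pmf (iid_sum_pmf p r) (n - m) else 0) \<partial>iid_sum_pmf p a)"
    using reach
    by (intro integral_mono)
      (auto intro!: measure_pmf.integrable_const_bound[where B = 1] integrable_real_mult_indicator simp: pmf_le_1)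
  also have "\<dots> = pmf (iid_sum_pmf p N) n"
    by (simp add: pmf_iid_sum_add N(1))
  finally show ?thesis .
qed

text \<open>
  Setting aside a proportion \<open>\<kappa>\<close> of the copies costs the factor \<open>c ^ (\<kappa> * N)\<close> up to a constant, where \<open>c\<close>
  bounds from below the probabilities of the values \<open>0\<close>, \<open>1\<close> and \<open>k\<close>. The choice of \<open>\<kappa>\<close> makes this at least
  \<open>exp (- \<gamma> * N / 2)\<close>; then \<open>\<delta>\<close> is chosen so small, relative to \<open>\<kappa>\<close>, that the copies set aside can
  compensate all deviations of size \<open>2 * \<delta> * N\<close>. Since \<open>k\<close> exceeds the mean, compensation from below is
  possible even when the mean is larger than \<open>1\<close>.
\<close>

lemma iid_sum_lower_bound:
  fixes p :: "nat pmf" and \<alpha> :: real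
  assumes int: "integrable (measure_pmf p) (\<lambda>k. real k)" "integrable (measure_pmf p) (\<lambda>k. (real k)\<^sup>2)"
    and \<alpha>: "measure_pmf.expectation p real = \<alpha>"
    and pos: "0 < pmf p 0" "0 < pmf p 1" "0 < pmf p k" "0 < \<alpha>" "\<alpha> < real k" and "0 < \<gamma>"
  obtains \<delta> M where "0 < \<delta>" "0 < M"
    "\<And>N n. M \<le> N \<Longrightarrow> \<bar>real n - real N * \<alpha>\<bar> \<le> \<delta> * real N
      \<Longrightarrow> exp (- \<gamma> * real N) \<le> pmf (iid_sum_pmf p N) n"
proof -
  define c where "c = min (pmf p 0) (min (pmf p 1) (pmf p k))"
  have c: "0 < c" "c \<le> pmf p 0" "c \<le> pmf p 1" "c \<le> pmf p k" "c \<le> 1"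
    using pos pmf_le_1[of p 0] by (auto simp: c_def)
  define L where "L = - ln c"
  have L: "0 \<le> L" and cL: "c ^ r = exp (- L * real r)" for r
    using c by (simp_all add: L_def exp_of_nat_mult mult.commute[of "ln c"])
  \<comment> \<open>The summand 1 keeps the denominator positive when \<open>L = 0\<close>; the cap \<open>1 / 2\<close> ensures \<open>r \<le> N\<close>.\<close>
  define \<kappa> where "\<kappa> = min (1 / 2) (\<gamma> / (2 * (L + 1)))"
  have \<kappa>: "0 < \<kappa>" "\<kappa> \<le> 1 / 2"
    unfolding \<kappa>_def using L \<open>0 < \<gamma>\<close> by (simp_all only: min.cobounded1) simp
  have "\<kappa> \<le> \<gamma> / (2 * (L + 1))" by (simp add: \<kappa>_def)
  then have \<kappa>L: "\<kappa> * (2 * (L + 1)) \<le> \<gamma>"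
    using L by (simp add: field_simps)
  define \<delta> where "\<delta> = min (\<alpha> * \<kappa> / 2) ((real k - \<alpha>) * \<kappa> / 4)"
  have \<delta>: "0 < \<delta>" "\<delta> \<le> \<alpha> * \<kappa> / 2" "\<delta> \<le> (real k - \<alpha>) * \<kappa> / 4"
    using pos \<kappa> by (auto simp: \<delta>_def)
  let ?v = "measure_pmf.variance p real"
  \<comment> \<open>The four bounds serve, in this order, \<open>r \<le> N\<close>, Chebyshev's inequality, the remainder term
      \<open>k\<^sup>2\<close>, and the absorption of the constant factor \<open>c / 2\<close> into \<open>exp (- \<gamma> * N / 2)\<close>.\<close>
  define M where "M = nat \<lceil>Max {2, 2 * ?v / \<delta>\<^sup>2, 2 * (real k)\<^sup>2 / ((real k - \<alpha>) * \<kappa>), 2 * (L + ln 2) / \<gamma>}\<rceil>"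
  show ?thesis
  proof (rule that)
    show "0 < \<delta>" by fact
    show "0 < M" unfolding M_def by (auto simp: Max_gr_iff)
    fix N n assume "M \<le> N" and n: "\<bar>real n - real N * \<alpha>\<bar> \<le> \<delta> * real N"
    then have "Max {2, 2 * ?v / \<delta>\<^sup>2, 2 * (real k)\<^sup>2 / ((real k - \<alpha>) * \<kappa>), 2 * (L + ln 2) / \<gamma>} \<le> real N"
      unfolding M_def by linarith
    then have N: "2 \<le> real N" "2 * ?v / \<delta>\<^sup>2 \<le> real N" "2 * (real k)\<^sup>2 / ((real k - \<alpha>) * \<kappa>) \<le> real N"
      "2 * (L + ln 2) / \<gamma> \<le> real N"
      by (simp_all del: times_divide_eq_right)
    define r where "r = nat \<lceil>\<kappa> * real N\<rceil>"
    have r: "\<kappa> * real N \<le> real r" "real r \<le> \<kappa> * real N + 1"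
      unfolding r_def using \<kappa> by (auto intro: of_nat_ceiling)
    have "\<kappa> * real N \<le> 1 / 2 * real N" using \<kappa> by (intro mult_right_mono) auto
    with r N have rN: "r \<le> N" by linarith
    have N2: "2 * ?v \<le> \<delta>\<^sup>2 * real N" using N(2) \<delta>(1) by (simp add: field_simps)
    have N3: "2 * (real k)\<^sup>2 \<le> (real k - \<alpha>) * \<kappa> * real N"
      using N(3) \<kappa> pos by (simp add: pos_divide_le_eq mult.commute)
    have N4: "2 * (L + ln 2) \<le> \<gamma> * real N"
      using N(4) \<open>0 < \<gamma>\<close> by (simp add: field_simps)
    have room1: "2 * \<delta> * real N \<le> \<alpha> * real r"
    proof -
      have "2 * \<delta> * real N \<le> \<alpha> * \<kappa> * real N" using \<delta>(2) by (intro mult_right_mono) auto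
      also have "\<dots> \<le> \<alpha> * real r" using r pos by (simp add: mult.assoc)
      finally show ?thesis .
    qed
    have room2: "2 * \<delta> * real N + (real k)\<^sup>2 \<le> (real k - \<alpha>) * real r"
    proof -
      have "4 * \<delta> * real N \<le> (real k - \<alpha>) * \<kappa> * real N" using \<delta>(3) by (intro mult_right_mono) auto
      moreover have "(real k - \<alpha>) * \<kappa> * real N \<le> (real k - \<alpha>) * real r"
        using r pos by (simp add: mult.assoc)
      ultimately show ?thesis using N3 by linarith
    qed
    have kpos: "0 < k" using pos by simp
    have "c ^ r / 2 \<le> pmf (iid_sum_pmf p N) n"
      by (rule iid_sum_lower_bound_split[OF int \<alpha> _ c(2-4) \<delta>(1) kpos rN _ N2 n room1 room2])
        (use c N in auto)
    moreover have "exp (- \<gamma> * real N) \<le> c ^ r / 2"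
    proof -
      have "L * real r \<le> L * (\<kappa> * real N + 1)"
        using r L by (intro mult_left_mono) auto
      moreover have "\<kappa> * (2 * L) * real N \<le> \<gamma> * real N"
        using \<kappa>L \<kappa> by (intro mult_right_mono) (auto simp: algebra_simps)
      ultimately have "L * real r + ln 2 \<le> \<gamma> * real N"
        using N4 by (simp add: algebra_simps)
      then have "exp (- \<gamma> * real N) \<le> exp (- (L * real r + ln 2))" by simp
      also have "\<dots> = c ^ r / 2" by (simp add: cL exp_diff)
      finally show ?thesis .
    qed
    ultimately show "exp (- \<gamma> * real N) \<le> pmf (iid_sum_pmf p N) n" by simp
  qed
qed

text \<open>
  Otherwise the variable would stay below its mean, hence be constant, contradicting that it takes
  both values \<open>0\<close> and \<open>1\<close>.
\<close>

lemma exists_pmf_gt_mean: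
  fixes p :: "nat pmf"
  assumes int: "integrable (measure_pmf p) (\<lambda>k. real k)"
    and "0 < pmf p 0" "0 < pmf p 1"
  obtains k where "0 < pmf p k" "measure_pmf.expectation p real < real k"
proof (rule ccontr)
  assume "\<not> thesis"
  with that have "\<And>k. 0 < pmf p k \<Longrightarrow> real k \<le> measure_pmf.expectation p real"
    by (meson not_less)
  then have le: "AE k in measure_pmf p. 0 \<le> measure_pmf.expectation p real - real k"
    by (auto simp: AE_measure_pmf_iff set_pmf_iff pmf_positive_iff)
  have "AE k in measure_pmf p. measure_pmf.expectation p real - real k = 0"
    using integral_nonneg_eq_0_iff_AE[OF _ le] int by simp
  then have "\<forall>k\<in>set_pmf p. measure_pmf.expectation p real = real k"
    by (simp add: AE_measure_pmf_iff)
  moreover have "0 \<in> set_pmf p" "1 \<in> set_pmf p"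
    using assms by (auto simp: set_pmf_iff)
  ultimately have "measure_pmf.expectation p real = real 0" "measure_pmf.expectation p real = real 1"
    by blast+
  then show False by simp
qed

lemma alloc_series_pos:
  assumes nonneg: "\<And>k. 0 \<le> b k" and b0: "0 < b 0"
    and \<theta>: "0 < \<theta>" "ereal \<theta> < alloc_radius b"
  shows "0 < alloc_series b \<theta>"
  unfolding alloc_series_def
  using nonneg b0 \<theta>(1)
  by (intro suminf_pos2[OF sums_summable[OF alloc_series_sums[OF \<theta>]], of 0]) auto

text \<open>
  Inside the radius of convergence there is room for a larger parameter \<open>\<theta>'\<close>, and the ratio
  \<open>(\<theta> / \<theta>') ^ k\<close> absorbs any power of \<open>k\<close>.
\<close>

lemma integrable_pow_xi_pmf:
  assumes nonneg: "\<And>k. 0 \<le> b k" and b0: "0 < b 0"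
    and \<theta>: "0 < \<theta>" "ereal \<theta> < alloc_radius b"
  shows "integrable (measure_pmf (xi_pmf b \<theta>)) (\<lambda>k. real k ^ d)"
proof -
  obtain \<theta>' where \<theta>': "\<theta> < \<theta>'" "ereal \<theta>' < alloc_radius b"
    using ereal_dense2[OF \<theta>(2)] by auto
  define c where "c = ln (\<theta>' / \<theta>)"
  have "0 < c" using \<theta>(1) \<theta>'(1) by (simp add: c_def)
  then have "(\<lambda>k. real k ^ d * exp (- c * real k)) \<in> O(\<lambda>k. 1)"
    by real_asymp
  then have O: "(\<lambda>k. real k ^ d * exp (- c * real k) * \<theta>' ^ k) \<in> O(\<lambda>k. 1 * \<theta>' ^ k)"
    by (intro landau_o.big.mult) auto
  have geo: "real k ^ d * exp (- c * real k) * \<theta>' ^ k = real k ^ d * \<theta> ^ k" for k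
  proof -
    have "exp (- c) = \<theta> / \<theta>'" using \<theta>(1) \<theta>'(1) by (simp add: c_def exp_minus)
    then have "exp (- c * real k) = (\<theta> / \<theta>') ^ k"
      using exp_of_nat_mult[of k "- c"] by (simp only: mult.commute)
    then show ?thesis using \<theta>(1) \<theta>'(1) by (simp add: power_divide)
  qed
  have "(\<lambda>k. real k ^ d * \<theta> ^ k) \<in> O(\<lambda>k. \<theta>' ^ k)"
    using O unfolding geo mult_1 .
  then have "(\<lambda>k. (real k ^ d * \<theta> ^ k) * (b k / fact k)) \<in> O(\<lambda>k. \<theta>' ^ k * (b k / fact k))"
    by (intro landau_o.big.mult) auto
  moreover have "summable (\<lambda>k. norm (\<theta>' ^ k * (b k / fact k)))"
    using sums_summable[OF alloc_series_sums[of \<theta>' b]] \<theta> \<theta>' nonneg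
    by (simp add: abs_mult mult.commute[of "\<theta>' ^ _"])
  ultimately have "summable (\<lambda>k. (real k ^ d * \<theta> ^ k) * (b k / fact k))"
    by (rule summable_comparison_test_bigo[rotated])
  then have "summable (\<lambda>k. (real k ^ d * \<theta> ^ k) * (b k / fact k) / alloc_series b \<theta>)"
    by (rule summable_divide)
  then have "summable (\<lambda>k. real k ^ d * pmf (xi_pmf b \<theta>) k)"
    unfolding pmf_xi_pmf[OF assms] by (simp add: ac_simps)
  then have "integrable (count_space UNIV) (\<lambda>k. real k ^ d * pmf (xi_pmf b \<theta>) k)"
    by (simp add: integrable_count_space_nat_iff)
  then show ?thesis
    by (simp add: measure_pmf_eq_density integrable_density mult.commute)
qed

text \<open>
  The hypothesis \<open>b 1 > 0\<close> enters here: it makes corrections of the sum by single units possible. If, say,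
  only even values occurred, odd totals would have probability \<open>0\<close>.
\<close>

lemma sum_prob_subexponential:
  assumes nonneg: "\<And>k. 0 \<le> b k" and b0: "0 < b 0" and b1: "0 < b 1"
    and \<theta>: "0 < \<theta>" "ereal \<theta> < alloc_radius b" and "0 < \<gamma>"
  obtains \<delta> M where "0 < \<delta>"
    "\<And>N n. M \<le> N \<Longrightarrow> \<bar>real n / real N - xi_mean b \<theta>\<bar> < \<delta>
      \<Longrightarrow> exp (- \<gamma> * real N) \<le> pmf (iid_sum_pmf (xi_pmf b \<theta>) N) n"
proof -
  let ?p = "xi_pmf b \<theta>"
  note alloc_series_pos[OF nonneg b0 \<theta>]
  then have p01: "0 < pmf ?p 0" "0 < pmf ?p 1"
    using b0 b1 \<theta>(1) by (simp_all add: pmf_xi_pmf[OF nonneg b0 \<theta>])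
  have int: "integrable (measure_pmf ?p) (\<lambda>k. real k)" "integrable (measure_pmf ?p) (\<lambda>k. (real k)\<^sup>2)"
    using integrable_pow_xi_pmf[OF nonneg b0 \<theta>, of 1] integrable_pow_xi_pmf[OF nonneg b0 \<theta>, of 2]
    by simp_all
  have mean: "0 < xi_mean b \<theta>"
  proof -
    have "pmf ?p 1 = (\<integral>k. indicator {1} k \<partial>?p)"
      by (simp add: measure_pmf_single)
    also have "\<dots> \<le> xi_mean b \<theta>"
      unfolding xi_mean_def
    proof (intro integral_mono int(1))
      show "integrable (measure_pmf ?p) (indicator {1} :: nat \<Rightarrow> real)"
        by (rule measure_pmf.integrable_const_bound[where B = 1]) (auto simp: indicator_def)
    qed (simp add: indicator_def)
    finally show ?thesis using p01 by simp
  qed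
  obtain k where k: "0 < pmf ?p k" "measure_pmf.expectation ?p real < real k"
    using exists_pmf_gt_mean[OF int(1) p01] .
  obtain \<delta> M where \<delta>: "0 < \<delta>" "0 < M"
    "\<And>N n. M \<le> N \<Longrightarrow> \<bar>real n - real N * xi_mean b \<theta>\<bar> \<le> \<delta> * real N
      \<Longrightarrow> exp (- \<gamma> * real N) \<le> pmf (iid_sum_pmf ?p N) n"
    using iid_sum_lower_bound[OF int xi_mean_def[symmetric] p01 k(1) mean _ \<open>0 < \<gamma>\<close>] k(2)
    unfolding xi_mean_def by metis
  show ?thesis
  proof (rule that[OF \<delta>(1)])
    fix N n assume N: "M \<le> N" and n: "\<bar>real n / real N - xi_mean b \<theta>\<bar> < \<delta>"
    have "0 < N" using N \<delta>(2) by simp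
    then have "real n - real N * xi_mean b \<theta> = (real n / real N - xi_mean b \<theta>) * real N"
      by (simp add: field_simps)
    then have "\<bar>real n - real N * xi_mean b \<theta>\<bar> = \<bar>real n / real N - xi_mean b \<theta>\<bar> * real N"
      by (simp only: abs_mult abs_of_nat)
    also have "\<dots> \<le> \<delta> * real N" using n by (intro mult_right_mono) auto
    finally show "exp (- \<gamma> * real N) \<le> pmf (iid_sum_pmf ?p N) n" by (rule \<delta>(3)[OF N])
  qed
qed

section \<open>Change of parameter and conditioning on the sum\<close>

text \<open>
  The factor relating the two parameters depends on the configuration only through its total.
  This is the exponential-family property that makes the conditional law free of \<open>\<theta>\<close>.
\<close>

lemma pmf_xi_copies_tilt:
  assumes nonneg: "\<And>k. 0 \<le> b k" and b0: "0 < b 0"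
    and \<theta>: "0 < \<theta>" "ereal \<theta> < alloc_radius b"
    and \<theta>': "0 < \<theta>'" "ereal \<theta>' < alloc_radius b"
  shows "pmf (xi_copies b \<theta> N) x =
    (\<theta> / \<theta>') ^ (\<Sum>j=1..N. x j) * (alloc_series b \<theta>' / alloc_series b \<theta>) ^ N * pmf (xi_copies b \<theta>' N) x"
proof -
  note pos = alloc_series_pos[OF nonneg b0 \<theta>] alloc_series_pos[OF nonneg b0 \<theta>']
  have single: "pmf (xi_pmf b \<theta>) k =
      (\<theta> / \<theta>') ^ k * (alloc_series b \<theta>' / alloc_series b \<theta>) * pmf (xi_pmf b \<theta>') k" for k
    using pos \<theta>(1) \<theta>'(1)
    by (simp add: pmf_xi_pmf[OF nonneg b0 \<theta>] pmf_xi_pmf[OF nonneg b0 \<theta>'] power_divide field_simps)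
  show ?thesis
  proof (cases "\<forall>j. j \<notin> {1..N} \<longrightarrow> x j = 0")
    case True
    then have "pmf (xi_copies b t N) x = (\<Prod>j\<in>{1..N}. pmf (xi_pmf b t) (x j))" for t
      unfolding xi_copies_def by (intro pmf_Pi') auto
    then show ?thesis
      by (simp only: single prod.distrib power_sum prod_constant) simp
  next
    case False
    then have "pmf (xi_copies b t N) x = 0" for t
      unfolding xi_copies_def by (intro pmf_Pi_outside) auto
    then show ?thesis by simp
  qed
qed

lemma measure_xi_copies_tilt:
  assumes nonneg: "\<And>k. 0 \<le> b k" and b0: "0 < b 0"
    and \<theta>: "0 < \<theta>" "ereal \<theta> < alloc_radius b"
    and \<theta>': "0 < \<theta>'" "ereal \<theta>' < alloc_radius b"
    and A: "A \<subseteq> {x. (\<Sum>j=1..N. x j) = n}"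
  shows "measure (xi_copies b \<theta> N) A =
    (\<theta> / \<theta>') ^ n * (alloc_series b \<theta>' / alloc_series b \<theta>) ^ N * measure (xi_copies b \<theta>' N) A"
proof -
  let ?c = "(\<theta> / \<theta>') ^ n * (alloc_series b \<theta>' / alloc_series b \<theta>) ^ N"
  have "infsetsum (pmf (xi_copies b \<theta> N)) A = infsetsum (\<lambda>x. ?c * pmf (xi_copies b \<theta>' N) x) A"
    using A by (intro infsetsum_cong) (auto simp: pmf_xi_copies_tilt[OF nonneg b0 \<theta> \<theta>'])
  also have "\<dots> = ?c * infsetsum (pmf (xi_copies b \<theta>' N)) A"
    by (rule infsetsum_cmult_right) (auto intro: pmf_abs_summable)
  finally show ?thesis
    by (simp add: measure_pmf_conv_infsetsum)
qed

lemma sum_prob_xi_copies: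
  "measure (xi_copies b \<theta> N) {x. (\<Sum>j=1..N. x j) = n} = pmf (iid_sum_pmf (xi_pmf b \<theta>) N) n"
  by (simp add: iid_sum_pmf_def pmf_map xi_copies_def vimage_def)

text \<open>
  The tilting factor of numerator and denominator cancels, so the parameter \<open>\<theta>\<close> of the scheme can be
  exchanged for any other admissible \<open>\<theta>'\<close>.
\<close>

lemma cond_prob_xi_copies:
  assumes nonneg: "\<And>k. 0 \<le> b k" and b0: "0 < b 0"
    and \<theta>: "0 < \<theta>" "ereal \<theta> < alloc_radius b"
    and \<theta>': "0 < \<theta>'" "ereal \<theta>' < alloc_radius b"
    and k: "(\<Sum>j=1..N. k j) = n" "\<And>j. j \<notin> {1..N} \<Longrightarrow> k j = 0"
  shows "\<P>(x in measure_pmf (xi_copies b \<theta> N). (\<forall>j\<in>{1..N}. x j = k j) \<bar> (\<Sum>j=1..N. x j) = n) =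
    pmf (xi_copies b \<theta>' N) k / pmf (iid_sum_pmf (xi_pmf b \<theta>') N) n"
proof -
  define c where "c = (\<theta> / \<theta>') ^ n * (alloc_series b \<theta>' / alloc_series b \<theta>) ^ N"
  have c: "c \<noteq> 0"
    unfolding c_def using alloc_series_pos[OF nonneg b0 \<theta>] alloc_series_pos[OF nonneg b0 \<theta>'] \<theta>(1) \<theta>'(1) by simp
  let ?A = "{x. (\<forall>j\<in>{1..N}. x j = k j) \<and> (\<Sum>j=1..N. x j) = n}"
  have zero: "x j = 0" if "x \<in> set_pmf (xi_copies b \<theta>' N)" "j \<notin> {1..N}" for x j
    using that set_Pi_pmf_subset[of "{1..N}" 0 "\<lambda>_. xi_pmf b \<theta>'"]
    unfolding xi_copies_def by blast
  have unique: "x \<in> ?A \<longleftrightarrow> x \<in> {k}" if "x \<in> set_pmf (xi_copies b \<theta>' N)" for x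
  proof
    assume x: "x \<in> ?A"
    have "x j = k j" for j
    proof (cases "j \<in> {1..N}")
      case True
      with x show ?thesis by simp
    next
      case False
      with zero[OF that False] k(2)[OF False] show ?thesis by simp
    qed
    then show "x \<in> {k}" by auto
  qed (use k(1) in simp)
  have "measure (xi_copies b \<theta>' N) ?A = measure (xi_copies b \<theta>' N) {k}"
  proof (rule measure_pmf.finite_measure_eq_AE)
    show "AE x in measure_pmf (xi_copies b \<theta>' N). x \<in> ?A \<longleftrightarrow> x \<in> {k}"
      unfolding AE_measure_pmf_iff using unique by blast
  qed simp_all
  moreover have "measure (xi_copies b \<theta> N) ?A = c * measure (xi_copies b \<theta>' N) ?A"
    unfolding c_def by (rule measure_xi_copies_tilt[OF nonneg b0 \<theta> \<theta>']) auto
  moreover have "measure (xi_copies b \<theta> N) {x. (\<Sum>j=1..N. x j) = n} =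
      c * measure (xi_copies b \<theta>' N) {x. (\<Sum>j=1..N. x j) = n}"
    unfolding c_def by (rule measure_xi_copies_tilt[OF nonneg b0 \<theta> \<theta>']) auto
  ultimately show ?thesis
    using c by (simp add: cond_prob_def measure_pmf_single sum_prob_xi_copies[simplified])
qed

section \<open>Concentration for the free allocation\<close>

lemma Pi_pmf_count_Hoeffding:
  assumes "finite A" "0 \<le> t" "A \<noteq> {}"
  shows "measure (Pi_pmf A d (\<lambda>_. q))
      {f. t \<le> \<bar>(\<Sum>j\<in>A. indicator {s} (f j)) - real (card A) * pmf q s\<bar>}
    \<le> 2 * exp (- 2 * t\<^sup>2 / real (card A))"
proof -
  let ?P = "measure_pmf (Pi_pmf A d (\<lambda>_. q))"
  let ?X = "\<lambda>j f. indicator {s} (f j) :: real"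
  have E: "measure_pmf.expectation (Pi_pmf A d (\<lambda>_. q)) (?X j) = pmf q s" if "j \<in> A" for j
  proof -
    have "?X j = indicator ((\<lambda>f. f j) -` {s})"
      by (auto simp: indicator_def fun_eq_iff)
    then have "measure_pmf.expectation (Pi_pmf A d (\<lambda>_. q)) (?X j) = measure (map_pmf (\<lambda>f. f j) (Pi_pmf A d (\<lambda>_. q))) {s}"
      by simp
    also have "\<dots> = pmf q s"
      using that assms(1) by (simp add: Pi_pmf_component measure_pmf_single del: measure_map_pmf)
    finally show ?thesis .
  qed
  interpret Hoeffding_ineq ?P A ?X "\<lambda>_. 0" "\<lambda>_. 1" "\<Sum>j\<in>A. measure_pmf.expectation (Pi_pmf A d (\<lambda>_. q)) (?X j)"
  proof unfold_locales
    show "prob_space.indep_vars ?P (\<lambda>_. borel) ?X A"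
      using prob_space.indep_vars_compose2[OF prob_space_measure_pmf indep_vars_Pi_pmf[OF assms(1), of d "\<lambda>_. q"], of "\<lambda>_. indicator {s}" "\<lambda>_. borel"]
      by simp
  qed (auto simp: assms indicator_def)
  have "measure ?P {f \<in> space ?P. t \<le> \<bar>(\<Sum>j\<in>A. ?X j f) - (\<Sum>j\<in>A. measure_pmf.expectation (Pi_pmf A d (\<lambda>_. q)) (?X j))\<bar>}
     \<le> 2 * exp (- 2 * t\<^sup>2 / (\<Sum>j\<in>A. (1 - 0)\<^sup>2))"
    using assms by (intro Hoeffding_ineq_abs_ge) (auto simp: card_gt_0_iff)
  then show ?thesis by (simp add: E)
qed

text \<open>
  The colour-by-colour product is the form that the definition of an allocation scheme conditions;
  \<open>free_allocation_pmf_by_boxes\<close> below gives the box-by-box product, in which the boxes are visibly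
  independent and identically distributed.
\<close>

definition free_allocation_pmf :: "('k::finite \<Rightarrow> nat \<Rightarrow> real) \<Rightarrow> ('k \<Rightarrow> real) \<Rightarrow> nat \<Rightarrow> ('k \<Rightarrow> nat \<Rightarrow> nat) pmf" where
  "free_allocation_pmf b \<theta> N = Pi_pmf UNIV (\<lambda>_. 0) (\<lambda>i. xi_copies (b i) (\<theta> i) N)"

lemma free_allocation_pmf_by_boxes:
  "free_allocation_pmf b \<theta> N =
    map_pmf (\<lambda>f i j. f j i) (Pi_pmf {1..N} (\<lambda>_. 0) (\<lambda>_. Pi_pmf UNIV 0 (\<lambda>i. xi_pmf (b i) (\<theta> i))))"
  (is "_ = map_pmf ?T ?Q")
proof (rule pmf_eqI)
  fix k :: "'a \<Rightarrow> nat \<Rightarrow> nat"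
  have "inj ?T" by (auto simp: inj_def fun_eq_iff)
  then have "pmf (map_pmf ?T ?Q) (?T (\<lambda>j i. k i j)) = pmf ?Q (\<lambda>j i. k i j)"
    by (rule pmf_map_inj')
  then have "pmf (map_pmf ?T ?Q) k = pmf ?Q (\<lambda>j i. k i j)" by simp
  moreover have "pmf (free_allocation_pmf b \<theta> N) k = pmf ?Q (\<lambda>j i. k i j)"
  proof (cases "\<forall>i. \<forall>j. j \<notin> {1..N} \<longrightarrow> k i j = 0")
    case True
    then have "pmf (xi_copies (b i) (\<theta> i) N) (k i) = (\<Prod>j\<in>{1..N}. pmf (xi_pmf (b i) (\<theta> i)) (k i j))" for i
      unfolding xi_copies_def by (intro pmf_Pi') auto
    then have "pmf (free_allocation_pmf b \<theta> N) k =
        (\<Prod>i\<in>UNIV. \<Prod>j\<in>{1..N}. pmf (xi_pmf (b i) (\<theta> i)) (k i j))"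
      unfolding free_allocation_pmf_def by (subst pmf_Pi') auto
    moreover have "pmf ?Q (\<lambda>j i. k i j) =
        (\<Prod>j\<in>{1..N}. pmf (Pi_pmf UNIV 0 (\<lambda>i. xi_pmf (b i) (\<theta> i))) (\<lambda>i. k i j))"
      using True by (intro pmf_Pi' ext) blast+
    moreover have "\<dots> = (\<Prod>j\<in>{1..N}. \<Prod>i\<in>UNIV. pmf (xi_pmf (b i) (\<theta> i)) (k i j))"
      by (intro prod.cong refl pmf_Pi') auto
    moreover have "\<dots> = (\<Prod>i\<in>UNIV. \<Prod>j\<in>{1..N}. pmf (xi_pmf (b i) (\<theta> i)) (k i j))"
      by (rule prod.swap)
    ultimately show ?thesis by (simp only:)
  next
    case False
    then obtain i j where ij: "j \<notin> {1..N}" "k i j \<noteq> 0" by blast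
    then have "pmf (xi_copies (b i) (\<theta> i) N) (k i) = 0"
      unfolding xi_copies_def by (intro pmf_Pi_outside) blast+
    then have "(\<Prod>i\<in>UNIV. pmf (xi_copies (b i) (\<theta> i) N) (k i)) = 0"
      by (intro prod_zero) auto
    then have "pmf (free_allocation_pmf b \<theta> N) k = 0"
      unfolding free_allocation_pmf_def by (subst pmf_Pi') auto
    moreover have "pmf ?Q (\<lambda>j i. k i j) = 0"
      using ij by (intro pmf_Pi_outside) (auto simp: fun_eq_iff)
    ultimately show ?thesis by simp
  qed
  ultimately show "pmf (free_allocation_pmf b \<theta> N) k = pmf (map_pmf ?T ?Q) k" by simp
qed

lemma free_allocation_tail:
  fixes s :: "'k::finite \<Rightarrow> nat"
  assumes "0 \<le> \<epsilon>" "0 < N"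
  shows "measure (free_allocation_pmf b \<theta> N)
     {k. \<epsilon> \<le> \<bar>(\<Sum>j=1..N. indicator {s} (\<lambda>i. k i j)) / real N - (\<Prod>i\<in>UNIV. pmf (xi_pmf (b i) (\<theta> i)) (s i))\<bar>}
    \<le> 2 * exp (- 2 * \<epsilon>\<^sup>2 * real N)"
proof -
  let ?q = "Pi_pmf UNIV 0 (\<lambda>i. xi_pmf (b i) (\<theta> i))"
  have q: "pmf ?q s = (\<Prod>i\<in>UNIV. pmf (xi_pmf (b i) (\<theta> i)) (s i))"
    by (simp add: pmf_Pi)
  have *: "\<epsilon> \<le> \<bar>x / real N - y\<bar> \<longleftrightarrow> \<epsilon> * real N \<le> \<bar>x - real N * y\<bar>" for x y :: real
  proof -
    have "x - real N * y = (x / real N - y) * real N"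
      using \<open>0 < N\<close> by (simp add: field_simps)
    then have "\<bar>x - real N * y\<bar> = \<bar>x / real N - y\<bar> * real N"
      by (simp only: abs_mult abs_of_nat)
    then show ?thesis using \<open>0 < N\<close> by simp
  qed
  have "- 2 * (\<epsilon> * real N)\<^sup>2 / real N = - 2 * \<epsilon>\<^sup>2 * real N"
    using \<open>0 < N\<close> by (simp add: power2_eq_square)
  with Pi_pmf_count_Hoeffding[of "{1..N}" "\<epsilon> * real N" "\<lambda>_. 0" ?q s] assms show ?thesis
    by (simp add: free_allocation_pmf_by_boxes vimage_def * q)
qed

section \<open>From the free allocation to the allocation scheme\<close>

text \<open>
  The scheme gives each configuration with the prescribed totals its free probability divided by the
  probability \<open>P\<close> of the totals. These values already sum to \<open>1\<close>, so configurations with other totals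
  have probability \<open>0\<close> although the definition of a scheme does not mention them. Only finitely many
  configurations remain, and finite additivity gives the claim for every \<open>D\<close>. Should the set
  on the left not be measurable, its measure is \<open>0\<close> by convention. The value \<open>0\<close> outside the
  boxes \<open>1, \<dots>, N\<close> matches the default value in \<open>xi_copies\<close>.
\<close>

lemma allocation_transfer:
  fixes b :: "'k::finite \<Rightarrow> nat \<Rightarrow> real"
  assumes "prob_space M"
    and nonneg: "\<And>i k. 0 \<le> b i k" and b0: "\<And>i. 0 < b i 0"
    and \<theta>: "\<And>i. 0 < \<theta> i" "\<And>i. ereal (\<theta> i) < alloc_radius (b i)"
    and \<theta>': "\<And>i. 0 < \<theta>' i" "\<And>i. ereal (\<theta>' i) < alloc_radius (b i)"
    and scheme: "allocation_scheme M b \<theta> n N \<eta>"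
    and pos: "\<And>i. 0 < pmf (iid_sum_pmf (xi_pmf (b i) (\<theta>' i)) N) (n i)"
  shows "measure M {\<omega> \<in> space M. (\<lambda>i j. if j \<in> {1..N} then \<eta> i j \<omega> else 0) \<in> D} \<le>
    measure (free_allocation_pmf b \<theta>' N) D / (\<Prod>i\<in>UNIV. pmf (iid_sum_pmf (xi_pmf (b i) (\<theta>' i)) N) (n i))"
proof -
  interpret prob_space M by fact
  define \<zeta> where "\<zeta> \<omega> = (\<lambda>i j. if j \<in> {1..N} then \<eta> i j \<omega> else 0)" for \<omega>
  let ?Q = "free_allocation_pmf b \<theta>' N"
  define P where "P = (\<Prod>i\<in>UNIV. pmf (iid_sum_pmf (xi_pmf (b i) (\<theta>' i)) N) (n i))"
  have P: "0 < P" unfolding P_def by (intro prod_pos) (use pos in auto)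
  define Z where "Z = {x :: nat \<Rightarrow> nat. \<forall>j. j \<notin> {1..N} \<longrightarrow> x j = 0}"
  define K where "K = Pi UNIV (\<lambda>i. {x. (\<Sum>j=1..N. x j) = n i} \<inter> Z)"
  have meas [measurable]: "\<eta> i j \<in> measurable M (count_space UNIV)" if "j \<in> {1..N}" for i j
    using scheme that unfolding allocation_scheme_def by blast
  have law: "prob {\<omega> \<in> space M. \<zeta> \<omega> = k} = pmf ?Q k / P"
    and ev: "{\<omega> \<in> space M. \<zeta> \<omega> = k} \<in> events" if "k \<in> K" for k
  proof -
    have k: "(\<Sum>j=1..N. k i j) = n i" "j \<notin> {1..N} \<Longrightarrow> k i j = 0" for i j
      using that by (auto simp: K_def Z_def Pi_iff)
    have "\<zeta> \<omega> = k \<longleftrightarrow> (\<forall>j\<in>{1..N}. \<forall>i. \<eta> i j \<omega> = k i j)" for \<omega>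
      using k(2) by (auto simp: \<zeta>_def fun_eq_iff)
    then have eq: "{\<omega> \<in> space M. \<zeta> \<omega> = k} = {\<omega> \<in> space M. \<forall>j\<in>{1..N}. \<forall>i. \<eta> i j \<omega> = k i j}"
      by simp
    then have "prob {\<omega> \<in> space M. \<zeta> \<omega> = k} = (\<Prod>i\<in>UNIV. \<P>(x in measure_pmf (xi_copies (b i) (\<theta> i) N).
            (\<forall>j\<in>{1..N}. x j = k i j) \<bar> (\<Sum>j=1..N. x j) = n i))"
      using scheme k(1) unfolding allocation_scheme_def by simp
    also have "\<dots> = (\<Prod>i\<in>UNIV. pmf (xi_copies (b i) (\<theta>' i) N) (k i) /
        pmf (iid_sum_pmf (xi_pmf (b i) (\<theta>' i)) N) (n i))"
      by (intro prod.cong refl cond_prob_xi_copies[OF nonneg b0 \<theta> \<theta>'] k)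
    also have "\<dots> = pmf ?Q k / P"
      by (simp add: prod_dividef P_def free_allocation_pmf_def pmf_Pi)
    finally show "prob {\<omega> \<in> space M. \<zeta> \<omega> = k} = pmf ?Q k / P" .
    show "{\<omega> \<in> space M. \<zeta> \<omega> = k} \<in> events"
      unfolding eq by measurable
  qed
  have fin: "finite K"
  proof (rule finite_subset)
    let ?B = "{x. \<forall>j. (j \<in> {1..N} \<longrightarrow> x j \<in> {..\<Sum>i\<in>UNIV. n i}) \<and> (j \<notin> {1..N} \<longrightarrow> x j = 0)}"
    show "K \<subseteq> {k. \<forall>i. (i \<in> UNIV \<longrightarrow> k i \<in> ?B) \<and> (i \<notin> UNIV \<longrightarrow> k i = undefined)}"
    proof (intro subsetI CollectI allI conjI impI)
      fix k i j assume "k \<in> K" "j \<in> {1..N}"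
      then have "k i j \<le> n i"
        using member_le_sum[of j "{1..N}" "k i"] by (auto simp: K_def Pi_iff)
      also have "\<dots> \<le> (\<Sum>i\<in>UNIV. n i)" by (rule member_le_sum) auto
      finally show "k i j \<in> {..\<Sum>i\<in>UNIV. n i}" by simp
    qed (auto simp: K_def Z_def)
    show "finite {k. \<forall>i. (i \<in> (UNIV :: 'k set) \<longrightarrow> k i \<in> ?B) \<and> (i \<notin> UNIV \<longrightarrow> k i = undefined)}"
      by (intro finite_set_of_finite_funs) auto
  qed
  have QK: "measure ?Q K = P"
  proof -
    have "measure (xi_copies (b i) (\<theta>' i) N) ({x. (\<Sum>j=1..N. x j) = n i} \<inter> Z) =
        pmf (iid_sum_pmf (xi_pmf (b i) (\<theta>' i)) N) (n i)" for i
    proof -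
      have "set_pmf (xi_copies (b i) (\<theta>' i) N) \<subseteq> Z"
        unfolding xi_copies_def Z_def by (rule set_Pi_pmf_subset) simp
      then have "{x. (\<Sum>j=1..N. x j) = n i} \<inter> Z \<inter> set_pmf (xi_copies (b i) (\<theta>' i) N) =
          {x. (\<Sum>j=1..N. x j) = n i} \<inter> set_pmf (xi_copies (b i) (\<theta>' i) N)" by blast
      then show ?thesis by (metis measure_Int_set_pmf sum_prob_xi_copies)
    qed
    then show ?thesis
      by (simp add: free_allocation_pmf_def K_def measure_Pi_pmf_Pi P_def)
  qed
  have union: "prob (\<Union>k\<in>K'. {\<omega> \<in> space M. \<zeta> \<omega> = k}) = measure ?Q K' / P" if "K' \<subseteq> K" for K'
  proof -
    have "finite K'" using fin that by (rule finite_subset[rotated])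
    then have "prob (\<Union>k\<in>K'. {\<omega> \<in> space M. \<zeta> \<omega> = k}) = (\<Sum>k\<in>K'. prob {\<omega> \<in> space M. \<zeta> \<omega> = k})"
      using that by (intro finite_measure_finite_Union) (auto simp: disjoint_family_on_def ev)
    also have "\<dots> = (\<Sum>k\<in>K'. pmf ?Q k / P)"
      using that by (intro sum.cong refl law) auto
    also have "\<dots> = measure ?Q K' / P"
      using \<open>finite K'\<close> by (simp add: sum_divide_distrib measure_measure_pmf_finite)
    finally show ?thesis .
  qed
  let ?U = "\<Union>k\<in>K. {\<omega> \<in> space M. \<zeta> \<omega> = k}" and ?V = "\<Union>k\<in>K \<inter> D. {\<omega> \<in> space M. \<zeta> \<omega> = k}"
  have U: "?U \<in> events" and V: "?V \<in> events"
    using fin ev by (auto intro!: sets.finite_UN)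
  \<comment> \<open>The configurations with the prescribed totals exhaust the probability, so the others are null.\<close>
  have "prob ?U = 1" using union[of K] QK P by simp
  then have U0: "prob (space M - ?U) = 0" using prob_compl[OF U] by simp
  have "{\<omega> \<in> space M. \<zeta> \<omega> \<in> D} \<subseteq> (space M - ?U) \<union> ?V" by auto
  then have "prob {\<omega> \<in> space M. \<zeta> \<omega> \<in> D} \<le> prob ((space M - ?U) \<union> ?V)"
    using U V by (intro finite_measure_mono) auto
  also have "\<dots> \<le> prob (space M - ?U) + prob ?V"
    using U V by (intro measure_Un_le) auto
  also have "\<dots> = measure ?Q (K \<inter> D) / P" using U0 union[of "K \<inter> D"] by simp
  also have "\<dots> \<le> measure ?Q D / P"
    using P by (intro divide_right_mono measure_pmf.finite_measure_mono) auto
  finally show ?thesis by (simp add: \<zeta>_def P_def)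
qed

lemma box_count_eq:
  "box_count s N \<eta> \<omega> = (\<Sum>j=1..N. indicator {s} (\<lambda>i. if j \<in> {1..N} then \<eta> i j \<omega> else 0))"
  unfolding box_count_def
proof (rule sum.cong)
  fix j assume j: "j \<in> {1..N}"
  show "(\<Prod>i\<in>UNIV. indicator {\<omega>'. \<eta> i j \<omega>' = s i} \<omega>) =
    (indicator {s} (\<lambda>i. if j \<in> {1..N} then \<eta> i j \<omega> else 0) :: real)"
  proof (cases "\<forall>i. \<eta> i j \<omega> = s i")
    case True
    with j show ?thesis by (auto simp: indicator_def fun_eq_iff)
  next
    case False
    with j show ?thesis by (auto simp: indicator_def fun_eq_iff intro!: prod_zero)
  qed
qed simp

lemma box_count_measurable:
  assumes "allocation_scheme M b \<theta> n N \<eta>"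
  shows "box_count s N \<eta> \<in> borel_measurable M"
proof -
  have meas: "\<eta> i j \<in> measurable M (count_space UNIV)" if "j \<in> {1..N}" for i j
    using assms that unfolding allocation_scheme_def by blast
  have "(\<lambda>\<omega>. \<Sum>j=1..N. \<Prod>i\<in>UNIV. indicator {\<omega>'. \<eta> i j \<omega>' = s i} \<omega>) =
    (\<lambda>\<omega>. \<Sum>j=1..N. \<Prod>i\<in>UNIV. (indicator {s i} (\<eta> i j \<omega>) :: real))"
    by (simp add: indicator_def)
  also have "\<dots> \<in> borel_measurable M"
    by (intro borel_measurable_sum borel_measurable_prod measurable_compose[OF meas]) auto
  finally show ?thesis unfolding box_count_def .
qed

lemma box_count_tail:
  fixes b :: "'k::finite \<Rightarrow> nat \<Rightarrow> real"
  assumes M: "prob_space M"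
    and nonneg: "\<And>i k. 0 \<le> b i k" and b0: "\<And>i. 0 < b i 0"
    and \<theta>: "\<And>i. 0 < \<theta> i" "\<And>i. ereal (\<theta> i) < alloc_radius (b i)"
    and \<theta>': "\<And>i. 0 < \<theta>' i" "\<And>i. ereal (\<theta>' i) < alloc_radius (b i)"
    and scheme: "allocation_scheme M b \<theta> n N \<eta>"
    and pos: "\<And>i. 0 < pmf (iid_sum_pmf (xi_pmf (b i) (\<theta>' i)) N) (n i)"
    and "0 \<le> \<epsilon>" "0 < N"
  shows "measure M {\<omega> \<in> space M. \<epsilon> \<le> \<bar>1 / real N * box_count s N \<eta> \<omega> -
            (\<Prod>i\<in>UNIV. pmf (xi_pmf (b i) (\<theta>' i)) (s i))\<bar>} \<le>
    2 * exp (- 2 * \<epsilon>\<^sup>2 * real N) / (\<Prod>i\<in>UNIV. pmf (iid_sum_pmf (xi_pmf (b i) (\<theta>' i)) N) (n i))"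
proof -
  let ?D = "{k. \<epsilon> \<le> \<bar>(\<Sum>j=1..N. indicator {s} (\<lambda>i. k i j)) / real N -
      (\<Prod>i\<in>UNIV. pmf (xi_pmf (b i) (\<theta>' i)) (s i))\<bar>}"
  have "{\<omega> \<in> space M. \<epsilon> \<le> \<bar>1 / real N * box_count s N \<eta> \<omega> -
            (\<Prod>i\<in>UNIV. pmf (xi_pmf (b i) (\<theta>' i)) (s i))\<bar>} =
      {\<omega> \<in> space M. (\<lambda>i j. if j \<in> {1..N} then \<eta> i j \<omega> else 0) \<in> ?D}"
    by (simp only: box_count_eq mem_Collect_eq mult_1_left times_divide_eq_left)
  then have "measure M {\<omega> \<in> space M. \<epsilon> \<le> \<bar>1 / real N * box_count s N \<eta> \<omega> -
            (\<Prod>i\<in>UNIV. pmf (xi_pmf (b i) (\<theta>' i)) (s i))\<bar>} \<le>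
      measure (free_allocation_pmf b \<theta>' N) ?D / (\<Prod>i\<in>UNIV. pmf (iid_sum_pmf (xi_pmf (b i) (\<theta>' i)) N) (n i))"
    using allocation_transfer[OF M nonneg b0 \<theta> \<theta>' scheme pos, of ?D] by simp
  also have "\<dots> \<le> 2 * exp (- 2 * \<epsilon>\<^sup>2 * real N) / (\<Prod>i\<in>UNIV. pmf (iid_sum_pmf (xi_pmf (b i) (\<theta>' i)) N) (n i))"
    using assms by (intro divide_right_mono free_allocation_tail prod_nonneg) auto
  finally show ?thesis .
qed

section \<open>Almost sure convergence along a multi-index\<close>

text \<open>
  For fixed \<open>N\<close> at most \<open>(a * N + 1) ^ K\<close> vectors \<open>n\<close> have all ratios \<open>n i / N\<close> within \<open>\<delta>\<close> of \<open>\<alpha> i\<close>.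
  The union of the deviation events over these \<open>n\<close> thus still has summable probabilities in \<open>N\<close>, and
  the Borel--Cantelli lemma excludes all of them at once for large \<open>N\<close>.
\<close>

lemma (in prob_space) AE_multi_index_limit:
  fixes X :: "('k::finite \<Rightarrow> nat) \<Rightarrow> nat \<Rightarrow> 'a \<Rightarrow> real" and \<alpha> :: "'k \<Rightarrow> real"
  assumes tail: "\<And>\<epsilon>. 0 < \<epsilon> \<Longrightarrow> \<exists>c>0. \<exists>C \<delta> M\<^sub>0. 0 < \<delta> \<and> (\<forall>N n.
      M\<^sub>0 \<le> N \<longrightarrow> (\<forall>i. 1 \<le> n i \<and> \<bar>real (n i) / real N - \<alpha> i\<bar> < \<delta>) \<longrightarrow>
      {\<omega> \<in> space M. \<epsilon> \<le> \<bar>X n N \<omega>\<bar>} \<in> events \<and>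
      prob {\<omega> \<in> space M. \<epsilon> \<le> \<bar>X n N \<omega>\<bar>} \<le> C * exp (- c * real N))"
  shows "AE \<omega> in M. \<forall>\<epsilon>>0. \<exists>M\<^sub>0. \<exists>\<delta>>0. \<forall>n N.
    M\<^sub>0 \<le> N \<and> (\<forall>i. M\<^sub>0 \<le> n i \<and> \<bar>real (n i) / real N - \<alpha> i\<bar> < \<delta>) \<longrightarrow> \<bar>X n N \<omega>\<bar> < \<epsilon>"
proof -
  have fixed: "AE \<omega> in M. \<exists>M\<^sub>0. \<exists>\<delta>>0. \<forall>n N.
      M\<^sub>0 \<le> N \<and> (\<forall>i. M\<^sub>0 \<le> n i \<and> \<bar>real (n i) / real N - \<alpha> i\<bar> < \<delta>) \<longrightarrow> \<bar>X n N \<omega>\<bar> < \<epsilon>"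
    if \<epsilon>: "0 < \<epsilon>" for \<epsilon>
  proof -
    obtain c C \<delta> M\<^sub>0 where "0 < c" "0 < \<delta>" and near: "\<And>N n. M\<^sub>0 \<le> N \<Longrightarrow>
        (\<forall>i. 1 \<le> n i \<and> \<bar>real (n i) / real N - \<alpha> i\<bar> < \<delta>) \<Longrightarrow>
        {\<omega> \<in> space M. \<epsilon> \<le> \<bar>X n N \<omega>\<bar>} \<in> events \<and>
        prob {\<omega> \<in> space M. \<epsilon> \<le> \<bar>X n N \<omega>\<bar>} \<le> C * exp (- c * real N)"
      using tail[OF \<epsilon>] by blast
    \<comment> \<open>From \<open>N \<ge> 1\<close> on, closeness of \<open>n i / N\<close> to \<open>\<alpha> i\<close> bounds \<open>n i\<close>; for \<open>N = 0\<close> the quotient is \<open>0\<close>.\<close>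
    define M\<^sub>1 where "M\<^sub>1 = max 1 M\<^sub>0"
    define G where "G N = (if N < M\<^sub>1 then {} else {n. \<forall>i. 1 \<le> n i \<and> \<bar>real (n i) / real N - \<alpha> i\<bar> < \<delta>})" for N
    define bad where "bad N = (\<Union>n\<in>G N. {\<omega> \<in> space M. \<epsilon> \<le> \<bar>X n N \<omega>\<bar>})" for N
    \<comment> \<open>A natural number bounding all ratios n i / N in question.\<close>
    define a where "a = nat \<lceil>(\<Sum>i\<in>UNIV. \<bar>\<alpha> i\<bar>) + \<delta>\<rceil>"
    have a: "\<bar>\<alpha> i\<bar> + \<delta> \<le> real a" for i
    proof -
      have "\<bar>\<alpha> i\<bar> \<le> (\<Sum>i\<in>UNIV. \<bar>\<alpha> i\<bar>)" by (rule member_le_sum) auto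
      then show ?thesis unfolding a_def by linarith
    qed
    have "0 < real a" using a[of undefined] \<open>0 < \<delta>\<close> by linarith
    have G: "G N \<subseteq> PiE UNIV (\<lambda>_. {..a * N})" for N
    proof
      fix n assume "n \<in> G N"
      then have n: "1 \<le> N" "\<bar>real (n i) / real N - \<alpha> i\<bar> < \<delta>" for i
        by (auto simp: G_def M\<^sub>1_def split: if_splits)
      have "real (n i) \<le> real (a * N)" for i
      proof -
        have "real (n i) / real N \<le> real a" using n(2)[of i] a[of i] by linarith
        then show ?thesis using n(1) by (simp add: divide_le_eq)
      qed
      then show "n \<in> PiE UNIV (\<lambda>_. {..a * N})" by (auto simp: PiE_iff simp flip: of_nat_mult)
    qed
    have finG: "finite (G N)" for N
      by (rule finite_subset[OF G]) (auto intro: finite_PiE)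
    have cardG: "real (card (G N)) \<le> (real a * real N + 1) ^ CARD('k)" for N
    proof -
      have "card (G N) \<le> card (PiE (UNIV :: 'k set) (\<lambda>_. {..a * N}))"
        by (rule card_mono[OF _ G]) (auto intro: finite_PiE)
      also have "\<dots> = (a * N + 1) ^ CARD('k)" by (simp add: card_PiE)
      finally have "real (card (G N)) \<le> real ((a * N + 1) ^ CARD('k))" by (rule of_nat_mono)
      then show ?thesis by (simp add: add.commute)
    qed
    have near': "{\<omega> \<in> space M. \<epsilon> \<le> \<bar>X n N \<omega>\<bar>} \<in> events"
      "prob {\<omega> \<in> space M. \<epsilon> \<le> \<bar>X n N \<omega>\<bar>} \<le> \<bar>C\<bar> * exp (- c * real N)" if "n \<in> G N" for n N
    proof -
      have "M\<^sub>0 \<le> N" "\<forall>i. 1 \<le> n i \<and> \<bar>real (n i) / real N - \<alpha> i\<bar> < \<delta>"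
        using that by (auto simp: G_def M\<^sub>1_def split: if_splits)
      note near[OF this]
      moreover have "C * exp (- c * real N) \<le> \<bar>C\<bar> * exp (- c * real N)"
        by (intro mult_right_mono) auto
      ultimately show "{\<omega> \<in> space M. \<epsilon> \<le> \<bar>X n N \<omega>\<bar>} \<in> events"
        "prob {\<omega> \<in> space M. \<epsilon> \<le> \<bar>X n N \<omega>\<bar>} \<le> \<bar>C\<bar> * exp (- c * real N)" by linarith+
    qed
    have bad: "bad N \<in> events" for N
      unfolding bad_def using finG near' by (intro sets.finite_UN) auto
    have bound: "prob (bad N) \<le> (real a * real N + 1) ^ CARD('k) * (\<bar>C\<bar> * exp (- c * real N))" for N
    proof -
      have "prob (bad N) \<le> (\<Sum>n\<in>G N. prob {\<omega> \<in> space M. \<epsilon> \<le> \<bar>X n N \<omega>\<bar>})"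
        unfolding bad_def using finG near' by (intro measure_UNION_le) auto
      also have "\<dots> \<le> real (card (G N)) * (\<bar>C\<bar> * exp (- c * real N))"
        using near'(2) by (rule sum_bounded_above)
      also have "\<dots> \<le> (real a * real N + 1) ^ CARD('k) * (\<bar>C\<bar> * exp (- c * real N))"
        using cardG by (intro mult_right_mono) auto
      finally show ?thesis .
    qed
    have "summable (\<lambda>N. (real a * real N + 1) ^ CARD('k) * exp (- c * real N))"
    proof (rule summable_comparison_test_bigo)
      show "(\<lambda>N. (real a * real N + 1) ^ CARD('k) * exp (- c * real N)) \<in> O(\<lambda>N. exp (- c / 2 * real N))"
        using \<open>0 < c\<close> \<open>0 < real a\<close> by real_asymp
      have "exp (- c / 2 * real N) = exp (- c / 2) ^ N" for N
        using exp_of_nat_mult[of N "- c / 2"] by (simp only: mult.commute)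
      then show "summable (\<lambda>N. norm (exp (- c / 2 * real N)))"
        using \<open>0 < c\<close> by (simp add: summable_geometric)
    qed
    then have "summable (\<lambda>N. \<bar>C\<bar> * ((real a * real N + 1) ^ CARD('k) * exp (- c * real N)))"
      by (rule summable_mult)
    then have "summable (\<lambda>N. (real a * real N + 1) ^ CARD('k) * (\<bar>C\<bar> * exp (- c * real N)))"
      by (simp only: mult.left_commute)
    then have "summable (\<lambda>N. prob (bad N))"
      by (rule summable_comparison_test'[where N = 0]) (use bound in simp)
    then have "AE \<omega> in M. eventually (\<lambda>N. \<omega> \<in> space M - bad N) sequentially"
      using bad by (intro borel_cantelli_AE1) (auto simp: emeasure_eq_measure)
    then show ?thesis
    proof (rule AE_mp, intro AE_I2 impI)
      fix \<omega> assume \<omega>: "\<omega> \<in> space M" and "eventually (\<lambda>N. \<omega> \<in> space M - bad N) sequentially"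
      then obtain N\<^sub>0 where N\<^sub>0: "\<And>N. N\<^sub>0 \<le> N \<Longrightarrow> \<omega> \<notin> bad N"
        by (auto simp: eventually_sequentially)
      show "\<exists>M\<^sub>0. \<exists>\<delta>>0. \<forall>n N.
          M\<^sub>0 \<le> N \<and> (\<forall>i. M\<^sub>0 \<le> n i \<and> \<bar>real (n i) / real N - \<alpha> i\<bar> < \<delta>) \<longrightarrow> \<bar>X n N \<omega>\<bar> < \<epsilon>"
      proof (intro exI[of _ "max N\<^sub>0 M\<^sub>1"] exI[of _ \<delta>] conjI allI impI)
        fix n N assume *: "max N\<^sub>0 M\<^sub>1 \<le> N \<and> (\<forall>i. max N\<^sub>0 M\<^sub>1 \<le> n i \<and> \<bar>real (n i) / real N - \<alpha> i\<bar> < \<delta>)"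
        then have "n \<in> G N" unfolding G_def M\<^sub>1_def by (auto simp: not_less)
        moreover have "\<omega> \<notin> bad N" using * by (intro N\<^sub>0) auto
        ultimately show "\<bar>X n N \<omega>\<bar> < \<epsilon>" using \<omega> by (auto simp: bad_def not_le)
      qed fact
    qed
  qed
  have "AE \<omega> in M. \<forall>m. \<exists>M\<^sub>0. \<exists>\<delta>>0. \<forall>n N.
      M\<^sub>0 \<le> N \<and> (\<forall>i. M\<^sub>0 \<le> n i \<and> \<bar>real (n i) / real N - \<alpha> i\<bar> < \<delta>) \<longrightarrow> \<bar>X n N \<omega>\<bar> < inverse (real (Suc m))"
    unfolding AE_all_countable by (intro allI fixed) simp
  then show ?thesis
  proof (rule AE_mp, intro AE_I2 impI allI)
    fix \<omega> and \<epsilon> :: real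
    assume all: "\<forall>m. \<exists>M\<^sub>0. \<exists>\<delta>>0. \<forall>n N.
      M\<^sub>0 \<le> N \<and> (\<forall>i. M\<^sub>0 \<le> n i \<and> \<bar>real (n i) / real N - \<alpha> i\<bar> < \<delta>) \<longrightarrow> \<bar>X n N \<omega>\<bar> < inverse (real (Suc m))"
    assume "0 < \<epsilon>"
    then obtain m where "inverse (real (Suc m)) < \<epsilon>" using reals_Archimedean by blast
    with all show "\<exists>M\<^sub>0. \<exists>\<delta>>0. \<forall>n N.
      M\<^sub>0 \<le> N \<and> (\<forall>i. M\<^sub>0 \<le> n i \<and> \<bar>real (n i) / real N - \<alpha> i\<bar> < \<delta>) \<longrightarrow> \<bar>X n N \<omega>\<bar> < \<epsilon>"
      by (meson less_trans)
  qed
qed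

section \<open>The strong law for box counts\<close>

theorem theorem2p3:
  fixes M :: "'w measure"
    and b :: "'k::finite \<Rightarrow> nat \<Rightarrow> real"
    and s :: "'k \<Rightarrow> nat"
    and \<alpha>\<^sub>0 \<theta>\<^sub>0 :: "'k \<Rightarrow> real"
    and \<theta> :: "('k \<Rightarrow> nat) \<Rightarrow> nat \<Rightarrow> 'k \<Rightarrow> real"
    and \<eta> :: "('k \<Rightarrow> nat) \<Rightarrow> nat \<Rightarrow> 'k \<Rightarrow> nat \<Rightarrow> 'w \<Rightarrow> nat"
  assumes "prob_space M"
    and "\<And>i k. 0 \<le> b i k" and "\<And>i. 0 < b i 0" and "\<And>i. 0 < b i 1"
    and "\<And>i. 0 < alloc_radius (b i)"
    and "\<And>i. 0 < \<theta>\<^sub>0 i" and "\<And>i. ereal (\<theta>\<^sub>0 i) < alloc_radius (b i)"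
    and "\<And>i. xi_mean (b i) (\<theta>\<^sub>0 i) = \<alpha>\<^sub>0 i"
    and "\<And>n N i. 0 < \<theta> n N i" and "\<And>n N i. ereal (\<theta> n N i) < alloc_radius (b i)"
    and "\<And>n N. \<lbrakk>1 \<le> N; \<And>i. 1 \<le> n i;
          \<And>i. 0 < \<P>(x in measure_pmf (xi_copies (b i) (\<theta> n N i) N). (\<Sum>j=1..N. x j) = n i)\<rbrakk>
        \<Longrightarrow> allocation_scheme M b (\<theta> n N) n N (\<eta> n N)"
  shows "AE \<omega> in M. \<forall>\<epsilon>>0. \<exists>M\<^sub>0. \<exists>\<delta>>0. \<forall>n N.
           M\<^sub>0 \<le> N \<and> (\<forall>i. M\<^sub>0 \<le> n i \<and> \<bar>real (n i) / real N - \<alpha>\<^sub>0 i\<bar> < \<delta>) \<longrightarrow>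
           \<bar>1 / real N * box_count s N (\<eta> n N) \<omega> -
             (\<Prod>i\<in>UNIV. b i (s i) * \<theta>\<^sub>0 i ^ s i / (fact (s i) * alloc_series (b i) (\<theta>\<^sub>0 i)))\<bar> < \<epsilon>"
proof -
  note nonneg = assms(2) and b0 = assms(3) and b1 = assms(4) and \<theta>\<^sub>0 = assms(6,7)
    and mean = assms(8) and \<theta> = assms(9,10) and scheme = assms(11)
  interpret prob_space M by fact
  let ?p = "\<lambda>i. xi_pmf (b i) (\<theta>\<^sub>0 i)"
  let ?L = "\<Prod>i\<in>UNIV. pmf (?p i) (s i)"
  have L: "(\<Prod>i\<in>UNIV. b i (s i) * \<theta>\<^sub>0 i ^ s i / (fact (s i) * alloc_series (b i) (\<theta>\<^sub>0 i))) = ?L"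
    by (intro prod.cong refl pmf_xi_pmf[symmetric] nonneg b0 \<theta>\<^sub>0)
  show ?thesis
    unfolding L
  proof (rule AE_multi_index_limit)
    fix \<epsilon> :: real assume "0 < \<epsilon>"
    \<comment> \<open>The K conditioning factors together then cost only \<open>exp (\<epsilon>\<^sup>2 * N)\<close>, half of the exponent in
        Hoeffding's inequality.\<close>
    define \<gamma> where "\<gamma> = \<epsilon>\<^sup>2 / real CARD('k)"
    have "0 < \<gamma>" using \<open>0 < \<epsilon>\<close> by (simp add: \<gamma>_def)
    have "\<exists>\<delta> m. 0 < \<delta> \<and> (\<forall>N n. m \<le> N \<longrightarrow> \<bar>real n / real N - \<alpha>\<^sub>0 i\<bar> < \<delta>
        \<longrightarrow> exp (- \<gamma> * real N) \<le> pmf (iid_sum_pmf (?p i) N) n)" for i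
      using sum_prob_subexponential[OF nonneg b0 b1 \<theta>\<^sub>0 \<open>0 < \<gamma>\<close>, of i] unfolding mean by metis
    then obtain \<delta> m where \<delta>: "\<And>i. 0 < \<delta> i" and low: "\<And>i N n. m i \<le> N \<Longrightarrow>
        \<bar>real n / real N - \<alpha>\<^sub>0 i\<bar> < \<delta> i \<Longrightarrow> exp (- \<gamma> * real N) \<le> pmf (iid_sum_pmf (?p i) N) n"
      by metis
    have "{\<omega> \<in> space M. \<epsilon> \<le> \<bar>1 / real N * box_count s N (\<eta> n N) \<omega> - ?L\<bar>} \<in> events \<and>
      prob {\<omega> \<in> space M. \<epsilon> \<le> \<bar>1 / real N * box_count s N (\<eta> n N) \<omega> - ?L\<bar>} \<le> 2 * exp (- \<epsilon>\<^sup>2 * real N)"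
      if N: "Max (insert 1 (range m)) \<le> N"
        and n: "\<forall>i. 1 \<le> n i \<and> \<bar>real (n i) / real N - \<alpha>\<^sub>0 i\<bar> < Min (range \<delta>)" for N n
    proof -
      have N1: "1 \<le> N" "m i \<le> N" for i using N by auto
      have low': "exp (- \<gamma> * real N) \<le> pmf (iid_sum_pmf (?p i) N) (n i)" for i
        using n by (intro low N1) auto
      have pos: "0 < pmf (iid_sum_pmf (?p i) N) (n i)" for i
        using low'[of i] by (rule less_le_trans[rotated]) simp
      have sch: "allocation_scheme M b (\<theta> n N) n N (\<eta> n N)"
      proof (rule scheme)
        fix i
        have "0 < (\<theta> n N i / \<theta>\<^sub>0 i) ^ n i * (alloc_series (b i) (\<theta>\<^sub>0 i) / alloc_series (b i) (\<theta> n N i)) ^ N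
            * pmf (iid_sum_pmf (?p i) N) (n i)"
          using \<theta>(1) \<theta>\<^sub>0(1) pos alloc_series_pos[OF nonneg b0 \<theta>] alloc_series_pos[OF nonneg b0 \<theta>\<^sub>0]
          by simp
        then show "0 < \<P>(x in measure_pmf (xi_copies (b i) (\<theta> n N i) N). (\<Sum>j=1..N. x j) = n i)"
          using measure_xi_copies_tilt[OF nonneg b0 \<theta> \<theta>\<^sub>0 order_refl, of i n N N "n i"]
          by (simp add: sum_prob_xi_copies[simplified])
      qed (use n N1 in auto)
      have [measurable]: "box_count s N (\<eta> n N) \<in> borel_measurable M"
        by (rule box_count_measurable[OF sch])
      have "exp (- \<epsilon>\<^sup>2 * real N) = (\<Prod>i\<in>(UNIV :: 'k set). exp (- \<gamma> * real N))"
        by (simp add: \<gamma>_def flip: exp_of_nat_mult)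
      also have "\<dots> \<le> (\<Prod>i\<in>UNIV. pmf (iid_sum_pmf (?p i) N) (n i))"
        by (intro prod_mono) (use low' in auto)
      finally have prod: "exp (- \<epsilon>\<^sup>2 * real N) \<le> (\<Prod>i\<in>UNIV. pmf (iid_sum_pmf (?p i) N) (n i))" .
      have "prob {\<omega> \<in> space M. \<epsilon> \<le> \<bar>1 / real N * box_count s N (\<eta> n N) \<omega> - ?L\<bar>}
        \<le> 2 * exp (- 2 * \<epsilon>\<^sup>2 * real N) / (\<Prod>i\<in>UNIV. pmf (iid_sum_pmf (?p i) N) (n i))"
        using \<open>0 < \<epsilon>\<close> N1(1)
        by (intro box_count_tail[OF \<open>prob_space M\<close> nonneg b0 \<theta> \<theta>\<^sub>0 sch pos]) auto
      also have "\<dots> \<le> 2 * exp (- 2 * \<epsilon>\<^sup>2 * real N) / exp (- \<epsilon>\<^sup>2 * real N)"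
        by (intro divide_left_mono prod mult_pos_pos prod_pos) (use pos in auto)
      also have "\<dots> = 2 * exp (- \<epsilon>\<^sup>2 * real N)"
      proof -
        have "exp (- 2 * \<epsilon>\<^sup>2 * real N) = exp (- \<epsilon>\<^sup>2 * real N) * exp (- \<epsilon>\<^sup>2 * real N)"
          by (simp flip: exp_add)
        then show ?thesis by (simp only:) simp
      qed
      finally show ?thesis by simp
    qed
    moreover have "0 < Min (range \<delta>)" using \<delta> by simp
    moreover have "0 < \<epsilon>\<^sup>2" using \<open>0 < \<epsilon>\<close> by simp
    ultimately show "\<exists>c>0. \<exists>C \<delta> M\<^sub>0. 0 < \<delta> \<and> (\<forall>N n.
      M\<^sub>0 \<le> N \<longrightarrow> (\<forall>i. 1 \<le> n i \<and> \<bar>real (n i) / real N - \<alpha>\<^sub>0 i\<bar> < \<delta>) \<longrightarrow>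
      {\<omega> \<in> space M. \<epsilon> \<le> \<bar>1 / real N * box_count s N (\<eta> n N) \<omega> - ?L\<bar>} \<in> events \<and>
      prob {\<omega> \<in> space M. \<epsilon> \<le> \<bar>1 / real N * box_count s N (\<eta> n N) \<omega> - ?L\<bar>} \<le> C * exp (- c * real N))"
      by blast
  qed
qed

end
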